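(* Let $(M,\mathcal{T})$, $\mathcal{T}=(V,E,F)$, be an infinitely triangulated surface with a PH metric $d_0$. Then there exists a global solution $u\in C_t^1(V\times[0,\infty))$ to the extended hyperbolic combinatorial Yamabe flow $$\frac{du_i}{dt}=-\widetilde K_i(u(t)),\qquad u_i(0)=0\qquad(i\in V,\ t\ge0).$$
   Context: Infinitely triangulated surface: $M$ is a surface and $\mathcal{T}=(V,E,F)$ is a locally finite triangulation of $M$ without boundary, with vertex set $V$ infinite (countable, vertices labelled by natural numbers), edge set $E$ and face set $F$. An edge is written $\{ij\}$, a face $\triangle ijk$. PH (piecewise hyperbolic) metric: a function $d:E\to(0,\infty)$ such that for each face $\triangle ijk\in F$ the numbers $d_{ij},d_{ik},d_{jk}$ satisfy the strict triangle inequalities, so that they are the side lengths of a nondegenerate hyperbolic triangle (curvature $-1$). Hyperbolic vertex scaling: for $u:V\to\mathbb{R}$, $u*d_0:E\to(0,\infty)$ is defined by $\sinh\frac{(u*d_0)_{ij}}{2}=e^{\frac{u_i+u_j}{2}}\sinh\frac{(d_0)_{ij}}{2}$. Extended angles: for $u:V\to\mathbb{R}$, a face $\triangle ijk\in F$ and $d=u*d_0$, set $\widetilde\theta_i^{jk}(u)$ to be the interior angle at $i$ of the hyperbolic triangle with side lengths $d_{ij},d_{ik},d_{jk}$ if these satisfy the strict triangle inequalities; $\widetilde\theta_i^{jk}(u)=\pi$ if $d_{jk}\ge d_{ij}+d_{ik}$; and $\widetilde\theta_i^{jk}(u)=0$ if $d_{ik}\ge d_{ij}+d_{jk}$ or $d_{ij}\ge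 d_{ik}+d_{jk}$. (At most one triangle inequality can fail, and $\widetilde\theta_i^{jk}$ is a continuous function of $(u_i,u_j,u_k)\in\mathbb{R}^3$.) The generalized combinatorial curvature, defined for every $u:V\to\mathbb{R}$, is $\widetilde K_i(u)=2\pi-\sum_{\triangle ijk\in F}\widetilde\theta_i^{jk}(u)$ (sum over faces containing $i$). $u\in C_t^1(V\times[0,\infty))$ means that $t\mapsto u_i(t)$ is $C^1$ on $[0,\infty)$ for every $i\in V$. *)

theory Defs
  imports "HOL-Analysis.Analysis"
begin

section \<open>Infinitely triangulated surfaces\<close>

text \<open>Surfaces are topological 2-manifolds without boundary; connectedness is not required.\<close>

definition surface :: "'a topology \<Rightarrow> bool" where
  "surface M \<longleftrightarrow>
     Hausdorff_space M \<and>
     (\<exists>\<B>. countable \<B> \<and> (\<forall>B\<in>\<B>. openin M B) \<and>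
        (\<forall>U x. openin M U \<and> x \<in> U \<longrightarrow> (\<exists>B\<in>\<B>. x \<in> B \<and> B \<subseteq> U))) \<and>
     (\<forall>x\<in>topspace M. \<exists>U W. openin M U \<and> x \<in> U \<and> open (W :: (real \<times> real) set) \<and>
        subtopology M U homeomorphic_space top_of_set W)"

text \<open>An edge or face is the set of its vertices, so triangulations are simplicial complexes.\<close>

definition simplices :: "nat set \<Rightarrow> nat set set \<Rightarrow> nat set set \<Rightarrow> nat set set" where
  "simplices V E F = (\<lambda>i. {i}) ` V \<union> E \<union> F"

definition simplicial_2_complex :: "nat set \<Rightarrow> nat set set \<Rightarrow> nat set set \<Rightarrow> bool" where
  "simplicial_2_complex V E F \<longleftrightarrow>
     (\<forall>e\<in>E. e \<subseteq> V \<and> card e = 2) \<and>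
     (\<forall>f\<in>F. f \<subseteq> V \<and> card f = 3 \<and> (\<forall>e. e \<subseteq> f \<and> card e = 2 \<longrightarrow> e \<in> E))"

text \<open>Barycentric coordinates. The ambient function space carries the product topology, which on
  the closed cell of a finite simplex is the Euclidean one.\<close>

definition closed_cell :: "nat set \<Rightarrow> (nat \<Rightarrow> real) set" where
  "closed_cell s = {x. (\<forall>i. 0 \<le> x i) \<and> (\<forall>i. i \<notin> s \<longrightarrow> x i = 0) \<and> (\<Sum>i\<in>s. x i) = 1}"

text \<open>The geometric realization, with the weak topology determined by its closed cells.\<close>

definition realization :: "nat set set \<Rightarrow> (nat \<Rightarrow> real) topology" where
  "realization K = topology (\<lambda>U. U \<subseteq> (\<Union>s\<in>K. closed_cell s) \<and>
     (\<forall>s\<in>K. openin (top_of_set (closed_cell s)) (U \<inter> closed_cell s)))"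

lemma openin_realization:
  "openin (realization K) U \<longleftrightarrow> U \<subseteq> (\<Union>s\<in>K. closed_cell s) \<and>
     (\<forall>s\<in>K. openin (top_of_set (closed_cell s)) (U \<inter> closed_cell s))"
proof -
  let ?P = "\<lambda>U. U \<subseteq> (\<Union>s\<in>K. closed_cell s) \<and>
     (\<forall>s\<in>K. openin (top_of_set (closed_cell s)) (U \<inter> closed_cell s))"
  have "istopology ?P"
    unfolding istopology_def
  proof (intro conjI allI impI)
    fix S T assume "?P S" "?P T"
    then show "S \<inter> T \<subseteq> (\<Union>s\<in>K. closed_cell s)" by blast
    have "S \<inter> T \<inter> c = (S \<inter> c) \<inter> (T \<inter> c)" for c by blast
    then show "\<forall>s\<in>K. openin (top_of_set (closed_cell s)) (S \<inter> T \<inter> closed_cell s)"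
      using \<open>?P S\<close> \<open>?P T\<close> by (metis openin_Int)
  next
    fix \<K> assume *: "\<forall>S\<in>\<K>. ?P S"
    then show "\<Union>\<K> \<subseteq> (\<Union>s\<in>K. closed_cell s)" by blast
    show "\<forall>s\<in>K. openin (top_of_set (closed_cell s)) (\<Union>\<K> \<inter> closed_cell s)"
    proof
      fix s assume "s \<in> K"
      have "\<Union>\<K> \<inter> closed_cell s = \<Union>((\<lambda>S. S \<inter> closed_cell s) ` \<K>)" by blast
      moreover have "openin (top_of_set (closed_cell s)) (\<Union>((\<lambda>S. S \<inter> closed_cell s) ` \<K>))"
        using * \<open>s \<in> K\<close> by (intro openin_Union) auto
      ultimately show "openin (top_of_set (closed_cell s)) (\<Union>\<K> \<inter> closed_cell s)" by simp
    qed
  qed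
  then show ?thesis
    unfolding realization_def by simp
qed

definition infinitely_triangulated_surface ::
  "'a topology \<Rightarrow> nat set \<Rightarrow> nat set set \<Rightarrow> nat set set \<Rightarrow> bool" where
  "infinitely_triangulated_surface M V E F \<longleftrightarrow>
     surface M \<and>
     simplicial_2_complex V E F \<and>
     realization (simplices V E F) homeomorphic_space M \<and>
     (\<forall>i\<in>V. finite {s \<in> simplices V E F. i \<in> s}) \<and>
     infinite V"

section \<open>Hyperbolic triangles\<close>

text \<open>The hyperbolic plane as the upper sheet of the hyperboloid in Minkowski space
  \<open>\<real> \<times> \<real>\<^sup>2\<close>, whose first coordinate is timelike.\<close>

definition mink :: "real \<times> real \<times> real \<Rightarrow> real \<times> real \<times> real \<Rightarrow> real" where
  "mink p q = snd p \<bullet> snd q - fst p * fst q"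

definition hyp_plane :: "(real \<times> real \<times> real) set" where
  "hyp_plane = {p. mink p p = -1 \<and> fst p > 0}"

definition hyp_dist :: "real \<times> real \<times> real \<Rightarrow> real \<times> real \<times> real \<Rightarrow> real" where
  "hyp_dist p q = arcosh (- mink p q)"

text \<open>The orthogonal projection of \<open>q\<close> to the tangent space at \<open>p\<close> is the initial
  direction (not normalized) of the geodesic from \<open>p\<close> to \<open>q\<close>.\<close>

definition hyp_direction :: "real \<times> real \<times> real \<Rightarrow> real \<times> real \<times> real \<Rightarrow> real \<times> real \<times> real" where
  "hyp_direction p q = q + mink p q *\<^sub>R p"

definition hyp_vertex_angle ::
  "real \<times> real \<times> real \<Rightarrow> real \<times> real \<times> real \<Rightarrow> real \<times> real \<times> real \<Rightarrow> real" where
  "hyp_vertex_angle p q r =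
     (let v = hyp_direction p q; w = hyp_direction p r
      in arccos (mink v w / (sqrt (mink v v) * sqrt (mink w w))))"

text \<open>The interior angle opposite to the side of length \<open>a\<close> in a hyperbolic triangle with side
  lengths \<open>a\<close>, \<open>b\<close>, \<open>c\<close>.\<close>

definition hyp_angle :: "real \<Rightarrow> real \<Rightarrow> real \<Rightarrow> real" where
  "hyp_angle a b c = (THE \<alpha>. \<exists>p\<in>hyp_plane. \<exists>q\<in>hyp_plane. \<exists>r\<in>hyp_plane.
     hyp_dist q r = a \<and> hyp_dist p q = b \<and> hyp_dist p r = c \<and> \<alpha> = hyp_vertex_angle p q r)"

lemma mink_sym: "mink p q = mink q p"
  by (simp add: mink_def inner_commute mult.commute)

lemma mink_le_minus_1:
  assumes "p \<in> hyp_plane" "q \<in> hyp_plane"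
  shows "mink p q \<le> -1"
proof -
  let ?x = "snd p" and ?y = "snd q"
  have p: "(fst p)\<^sup>2 = 1 + (norm ?x)\<^sup>2" "fst p > 0" and q: "(fst q)\<^sup>2 = 1 + (norm ?y)\<^sup>2" "fst q > 0"
    using assms unfolding hyp_plane_def mink_def power2_norm_eq_inner
    unfolding power2_eq_square by auto
  have "2 * (norm ?x * norm ?y) \<le> (norm ?x)\<^sup>2 + (norm ?y)\<^sup>2"
    using sum_squares_bound[of "norm ?x" "norm ?y"] by (simp only: mult.assoc)
  moreover have "(1 + norm ?x * norm ?y)\<^sup>2 = 1 + 2 * (norm ?x * norm ?y) + (norm ?x)\<^sup>2 * (norm ?y)\<^sup>2"
    by (simp add: power2_sum power_mult_distrib)
  moreover have "(fst p * fst q)\<^sup>2 = (1 + (norm ?x)\<^sup>2) * (1 + (norm ?y)\<^sup>2)"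
    by (simp only: power_mult_distrib p(1) q(1))
  then have "(fst p * fst q)\<^sup>2 = 1 + ((norm ?x)\<^sup>2 + (norm ?y)\<^sup>2) + (norm ?x)\<^sup>2 * (norm ?y)\<^sup>2"
    by (simp add: distrib_left distrib_right)
  ultimately have "(1 + norm ?x * norm ?y)\<^sup>2 \<le> (fst p * fst q)\<^sup>2"
    by linarith
  then have "1 + norm ?x * norm ?y \<le> fst p * fst q"
    by (rule power2_le_imp_le) (use p(2) q(2) in simp)
  moreover have "?x \<bullet> ?y \<le> norm ?x * norm ?y" by (rule norm_cauchy_schwarz)
  ultimately show ?thesis by (simp add: mink_def)
qed

lemma cosh_hyp_dist:
  assumes "p \<in> hyp_plane" "q \<in> hyp_plane"
  shows "mink p q = - cosh (hyp_dist p q)" "hyp_dist p q \<ge> 0"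
  using mink_le_minus_1[OF assms] by (auto simp: hyp_dist_def)

lemma mink_hyp_direction:
  assumes "p \<in> hyp_plane"
  shows "mink (hyp_direction p q) (hyp_direction p r) = mink q r + mink p q * mink p r"
proof -
  have "mink p p = -1" using assms by (simp add: hyp_plane_def)
  moreover have "mink (hyp_direction p q) (hyp_direction p r) =
      mink q r + mink p r * mink q p + mink p q * mink p r + mink p q * mink p r * mink p p"
    by (simp add: hyp_direction_def mink_def inner_simps algebra_simps)
  ultimately show ?thesis by (simp add: mink_sym algebra_simps)
qed

text \<open>Hyperbolic law of cosines.\<close>

lemma hyp_vertex_angle_eq:
  assumes p: "p \<in> hyp_plane" and q: "q \<in> hyp_plane" and r: "r \<in> hyp_plane"
    and "hyp_dist q r = a" "hyp_dist p q = b" "hyp_dist p r = c"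
  shows "hyp_vertex_angle p q r = arccos ((cosh b * cosh c - cosh a) / (sinh b * sinh c))"
proof -
  have s: "sqrt (mink (hyp_direction p x) (hyp_direction p x)) = sinh (hyp_dist p x)"
    if "x \<in> hyp_plane" for x
  proof -
    have "mink x x = -1" using that by (simp add: hyp_plane_def)
    then have "mink (hyp_direction p x) (hyp_direction p x) = (sinh (hyp_dist p x))\<^sup>2"
      using cosh_hyp_dist(1)[OF p that] by (simp add: mink_hyp_direction[OF p] sinh_square_eq flip: power2_eq_square)
    then show ?thesis using cosh_hyp_dist(2)[OF p that] by simp
  qed
  have "mink (hyp_direction p q) (hyp_direction p r) = cosh b * cosh c - cosh a"
    using assms cosh_hyp_dist(1) by (simp add: mink_hyp_direction)
  then show ?thesis
    using s[OF q] s[OF r] assms by (simp add: hyp_vertex_angle_def Let_def)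
qed

lemma hyp_triangle_exists:
  assumes "a > 0" "b > 0" "c > 0" "a < b + c" "b < a + c" "c < a + b"
  obtains p q r where "p \<in> hyp_plane" "q \<in> hyp_plane" "r \<in> hyp_plane"
    "hyp_dist q r = a" "hyp_dist p q = b" "hyp_dist p r = c"
proof -
  define C where "C = (cosh b * cosh c - cosh a) / (sinh b * sinh c)"
  have pos: "sinh b * sinh c > 0" using assms by simp
  have "cosh a \<le> cosh (b + c)"
    using assms by (subst cosh_real_nonneg_le_iff) auto
  then have lo: "-1 \<le> C"
    using pos unfolding C_def by (simp add: cosh_add pos_le_divide_eq)
  have "cosh (b - c) = cosh \<bar>b - c\<bar>" by (simp add: cosh_real_abs)
  also have "\<dots> \<le> cosh a"
    using assms by (subst cosh_real_nonneg_le_iff) auto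
  finally have hi: "C \<le> 1"
    using pos unfolding C_def by (simp add: cosh_diff pos_divide_le_eq)
  define S where "S = sqrt (1 - C\<^sup>2)"
  have CS: "S\<^sup>2 + C\<^sup>2 = 1"
    using lo hi unfolding S_def by (simp add: abs_square_le_1 abs_le_iff)
  have C: "sinh b * sinh c * C = cosh b * cosh c - cosh a"
    using assms unfolding C_def by simp
  let ?p = "(1, 0, 0) :: real \<times> real \<times> real"
  let ?q = "(cosh b, sinh b, 0) :: real \<times> real \<times> real"
  let ?r = "(cosh c, sinh c * C, sinh c * S) :: real \<times> real \<times> real"
  have "(sinh c * C)\<^sup>2 + (sinh c * S)\<^sup>2 = (sinh c)\<^sup>2 * (S\<^sup>2 + C\<^sup>2)"
    by (simp add: power_mult_distrib algebra_simps)
  then have "mink ?r ?r = -1"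
    using CS by (simp add: mink_def inner_prod_def cosh_square_eq flip: power2_eq_square)
  then have "?r \<in> hyp_plane" by (simp add: hyp_plane_def)
  moreover have "?p \<in> hyp_plane" by (simp add: hyp_plane_def mink_def inner_prod_def)
  moreover have "?q \<in> hyp_plane"
    by (simp add: hyp_plane_def mink_def inner_prod_def cosh_square_eq flip: power2_eq_square)
  moreover have "hyp_dist ?q ?r = a"
  proof -
    have "mink ?q ?r = sinh b * sinh c * C - cosh b * cosh c"
      by (simp add: mink_def inner_prod_def)
    then have "- mink ?q ?r = cosh a" using C by linarith
    then show ?thesis using assms by (simp add: hyp_dist_def arcosh_cosh_real)
  qed
  moreover have "hyp_dist ?p ?q = b" "hyp_dist ?p ?r = c"
    using assms by (simp_all add: hyp_dist_def mink_def inner_prod_def arcosh_cosh_real)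
  ultimately show thesis using that by blast
qed

lemma hyp_angle_eq:
  assumes "a > 0" "b > 0" "c > 0" "a < b + c" "b < a + c" "c < a + b"
  shows "hyp_angle a b c = arccos ((cosh b * cosh c - cosh a) / (sinh b * sinh c))"
proof -
  obtain p q r where pqr: "p \<in> hyp_plane" "q \<in> hyp_plane" "r \<in> hyp_plane"
    "hyp_dist q r = a" "hyp_dist p q = b" "hyp_dist p r = c"
    using hyp_triangle_exists[OF assms] .
  show ?thesis
    unfolding hyp_angle_def
  proof (rule the_equality)
    show "\<exists>p\<in>hyp_plane. \<exists>q\<in>hyp_plane. \<exists>r\<in>hyp_plane. hyp_dist q r = a \<and> hyp_dist p q = b \<and>
        hyp_dist p r = c \<and> arccos ((cosh b * cosh c - cosh a) / (sinh b * sinh c)) = hyp_vertex_angle p q r"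
      using pqr hyp_vertex_angle_eq[OF pqr] by (intro bexI[of _ p] bexI[of _ q] bexI[of _ r]) simp_all
  qed (auto intro: hyp_vertex_angle_eq)
qed

section \<open>Piecewise hyperbolic metrics and the extended Yamabe flow\<close>

text \<open>Functions on the edges are total on \<^typ>\<open>nat set\<close>; values off \<open>E\<close> are irrelevant.\<close>

definition PH_metric :: "nat set set \<Rightarrow> nat set set \<Rightarrow> (nat set \<Rightarrow> real) \<Rightarrow> bool" where
  "PH_metric E F d \<longleftrightarrow>
     (\<forall>e\<in>E. 0 < d e) \<and>
     (\<forall>i j k. {i, j, k} \<in> F \<longrightarrow> d {j, k} < d {i, j} + d {i, k})"

text \<open>Hyperbolic vertex scaling \<open>u * d\<close>, solved for the length of the edge.\<close>

definition vertex_scaling :: "(nat \<Rightarrow> real) \<Rightarrow> (nat set \<Rightarrow> real) \<Rightarrow> nat set \<Rightarrow> real" where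
  "vertex_scaling u d e = 2 * arsinh (exp ((\<Sum>i\<in>e. u i) / 2) * sinh (d e / 2))"

lemma sinh_vertex_scaling:
  assumes "i \<noteq> j"
  shows "sinh (vertex_scaling u d {i, j} / 2) = exp ((u i + u j) / 2) * sinh (d {i, j} / 2)"
  using assms by (simp add: vertex_scaling_def)

lemma vertex_scaling_pos: "d e > 0 \<Longrightarrow> vertex_scaling u d e > 0"
  by (simp add: vertex_scaling_def)

text \<open>The extended angle at \<open>i\<close> in the face \<open>{i, j, k}\<close> for the edge lengths \<open>d\<close>.\<close>

definition ext_angle :: "(nat set \<Rightarrow> real) \<Rightarrow> nat \<Rightarrow> nat \<Rightarrow> nat \<Rightarrow> real" where
  "ext_angle d i j k =
     (if d {j, k} \<ge> d {i, j} + d {i, k} then pi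
      else if d {i, k} \<ge> d {i, j} + d {j, k} \<or> d {i, j} \<ge> d {i, k} + d {j, k} then 0
      else hyp_angle (d {j, k}) (d {i, j}) (d {i, k}))"

text \<open>The condition \<open>j < k\<close> makes every face containing \<open>i\<close> count exactly once.\<close>

definition ext_curvature ::
  "nat set set \<Rightarrow> (nat set \<Rightarrow> real) \<Rightarrow> (nat \<Rightarrow> real) \<Rightarrow> nat \<Rightarrow> real" where
  "ext_curvature F d0 u i =
     2 * pi - (\<Sum>(j, k)\<in>{(j, k). j < k \<and> {i, j, k} \<in> F}. ext_angle (vertex_scaling u d0) i j k)"

text \<open>The class of all \<open>u\<close> such that \<open>u i\<close> is continuously differentiable on \<open>[0, \<infinity>)\<close> for every
  vertex \<open>i\<close>, with the one-sided derivative at \<open>0\<close>.\<close>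

definition C1_t :: "nat set \<Rightarrow> (nat \<Rightarrow> real \<Rightarrow> real) set" where
  "C1_t V = {u. \<forall>i\<in>V. \<exists>u'. continuous_on {0..} u' \<and>
     (\<forall>t\<ge>0. (u i has_real_derivative u' t) (at t within {0..}))}"

definition extended_Yamabe_flow_solution ::
  "nat set \<Rightarrow> nat set set \<Rightarrow> (nat set \<Rightarrow> real) \<Rightarrow> (nat \<Rightarrow> real \<Rightarrow> real) \<Rightarrow> bool" where
  "extended_Yamabe_flow_solution V F d0 u \<longleftrightarrow>
     (\<forall>i\<in>V. u i 0 = 0 \<and>
        (\<forall>t\<ge>0. (u i has_real_derivative - ext_curvature F d0 (\<lambda>j. u j t) i) (at t within {0..})))"

end

theory Submission
  imports Defs
begin

text \<open>The extended angle is the arc cosine of the quotient in the hyperbolic law of cosines,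
  truncated to \<open>[-1, 1]\<close>; hence the curvature at a vertex is a bounded function of \<open>u\<close> that is
  continuous for the product topology. For such vector fields the Euler step functions with
  initial value \<open>0\<close> are Lipschitz in each coordinate up to an error of one step,
  so by Tychonoff's theorem they have a pointwise cluster point as the step tends to \<open>0\<close>. That
  cluster point solves the flow equation, which is checked directly on difference quotients.\<close>

section \<open>Peano existence in an arbitrary product of lines\<close>

primrec euler ::
  "(('i \<Rightarrow> real) \<Rightarrow> 'i \<Rightarrow> real) \<Rightarrow> real \<Rightarrow> ('i \<Rightarrow> real) \<Rightarrow> nat \<Rightarrow> 'i \<Rightarrow> real" where
  "euler f h x 0 = x"
| "euler f h x (Suc k) = (\<lambda>i. euler f h x k i + h * f (euler f h x k) i)"

text \<open>Each step adds \<open>h\<close> times a velocity within \<open>e\<close> of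
  \<open>c\<close>, so the errors accumulate linearly. Only states visited at steps from
  \<open>m\<close> to \<open>k - 1\<close> enter. Taking \<open>c = 0\<close> yields the Lipschitz
  bound; taking for \<open>c\<close> the velocity at a limit point yields the derivative.\<close>

lemma euler_drift:
  assumes h: "h \<ge> 0" and "m \<le> k"
    and "\<And>l. m \<le> l \<Longrightarrow> l < k \<Longrightarrow> \<bar>f (euler f h x l) i - c\<bar> \<le> e"
  shows "\<bar>euler f h x k i - euler f h x m i - h * (real k - real m) * c\<bar> \<le> h * (real k - real m) * e"
  using assms(2,3)
proof (induction k rule: dec_induct)
  case base
  show ?case by simp
next
  case (step k)
  let ?D = "euler f h x k i - euler f h x m i - h * (real k - real m) * c"
  have 1: "\<bar>?D\<bar> \<le> h * (real k - real m) * e"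
    using step by simp
  have "\<bar>f (euler f h x k) i - c\<bar> \<le> e"
    using step by simp
  then have 2: "\<bar>h * (f (euler f h x k) i - c)\<bar> \<le> h * e"
    using h by (simp add: abs_mult mult_left_mono)
  have "euler f h x (Suc k) i - euler f h x m i - h * (real (Suc k) - real m) * c
      = ?D + h * (f (euler f h x k) i - c)"
    by (simp add: algebra_simps)
  moreover have "h * (real (Suc k) - real m) * e = h * (real k - real m) * e + h * e"
    by (simp add: algebra_simps)
  ultimately show ?case
    using 1 2 abs_triangle_ineq[of ?D "h * (f (euler f h x k) i - c)"] by linarith
qed

lemma euler_Lipschitz:
  assumes "h \<ge> 0" and bound: "\<And>x. \<bar>f x i\<bar> \<le> C"
  shows "\<bar>euler f h x k i - euler f h x m i\<bar> \<le> C * \<bar>h * real k - h * real m\<bar>"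
proof (induction k m rule: linorder_wlog)
  case (le m k)
  have "\<bar>euler f h x k i - euler f h x m i\<bar> \<le> h * (real k - real m) * C"
    using euler_drift[OF assms(1) le, of f x i 0 C] bound by simp
  moreover have "\<bar>h * real k - h * real m\<bar> = h * (real k - real m)"
    using assms(1) le by (simp flip: right_diff_distrib)
  ultimately show ?case by (simp add: abs_minus_commute mult.commute)
next
  case (sym k m)
  then show ?case by (simp add: abs_minus_commute)
qed

section \<open>Cluster points, basic neighbourhoods and one-sided derivatives\<close>

lemma compact_cluster_filter:
  fixes U :: "'n \<Rightarrow> 'a :: topological_space"
  assumes "compact K" "\<And>n. U n \<in> K" "F \<noteq> bot"
  obtains p G where "p \<in> K" "G \<noteq> bot" "G \<le> F" "(U \<longlongrightarrow> p) G"
proof -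
  have "filtermap U F \<noteq> bot" "eventually (\<lambda>x. x \<in> K) (filtermap U F)"
    using assms by (auto simp: filtermap_bot_iff eventually_filtermap)
  then obtain p where p: "p \<in> K" "inf (nhds p) (filtermap U F) \<noteq> bot"
    using \<open>compact K\<close> unfolding compact_filter by blast
  \<comment> \<open>Compactness alone need not provide a convergent subsequence, so a finer filter
    replaces it: \<open>F\<close> is refined by the preimages under \<open>U\<close> of the
    neighbourhoods of a cluster point. It is proper because \<open>U\<close> meets each such
    neighbourhood frequently along \<open>F\<close>.\<close>
  define G where "G = inf F (filtercomap U (nhds p))"
  have "\<not> eventually (\<lambda>_. False) G"
  proof
    assume "eventually (\<lambda>_. False) G"
    then obtain P Q where PQ: "eventually P F" "eventually Q (nhds p)" "\<And>n. P n \<Longrightarrow> Q (U n) \<Longrightarrow> False"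
      unfolding G_def eventually_inf eventually_filtercomap by metis
    have "eventually (\<lambda>x. \<not> Q x) (filtermap U F)"
      unfolding eventually_filtermap using PQ(1) by eventually_elim (use PQ(3) in blast)
    then have "eventually (\<lambda>_. False) (inf (nhds p) (filtermap U F))"
      unfolding eventually_inf using PQ(2) by blast
    then show False using p(2) by (simp add: eventually_False)
  qed
  moreover have "(U \<longlongrightarrow> p) G"
    unfolding filterlim_iff_le_filtercomap G_def by simp
  ultimately show thesis
    using p(1) that[of p G] by (simp add: G_def eventually_False)
qed

text \<open>Turns continuity for the product topology into a condition on finitely many coordinates
  \<open>J\<close>, which is all that can be controlled simultaneously along a filter.\<close>

lemma open_contains_product_basis:
  fixes x :: "'i \<Rightarrow> 'a :: topological_space"
  assumes "open S" "x \<in> S"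
  obtains X J where "finite J" "\<And>i. open (X i)" "\<And>i. x i \<in> X i"
    "\<And>y. (\<And>j. j \<in> J \<Longrightarrow> y j \<in> X j) \<Longrightarrow> y \<in> S"
proof -
  have "openin (product_topology (\<lambda>_. euclidean) UNIV) S"
    using assms(1) by (simp add: euclidean_product_topology)
  from product_topology_open_contains_basis[OF this assms(2)]
  obtain X where X: "x \<in> (\<Pi>\<^sub>E i\<in>UNIV. X i)" "\<And>i. open (X i)" "finite {i. X i \<noteq> UNIV}"
    "(\<Pi>\<^sub>E i\<in>UNIV. X i) \<subseteq> S"
    by auto
  show thesis
  proof (rule that[of "{i. X i \<noteq> UNIV}" X])
    fix y assume "\<And>j. j \<in> {i. X i \<noteq> UNIV} \<Longrightarrow> y j \<in> X j"
    then have "y \<in> (\<Pi>\<^sub>E i\<in>UNIV. X i)" by (auto simp: PiE_def Pi_def)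
    then show "y \<in> S" using X(4) by blast
  qed (use X in \<open>auto simp: PiE_def Pi_def\<close>)
qed

text \<open>Increments over ordered intervals \<open>[a, b]\<close> near \<open>t\<close> fit a
  scheme that runs forward in time; \<open>t\<close> serves as the right or the left endpoint
  according to the side of \<open>s\<close>.\<close>

lemma has_real_derivative_atLeast_0I:
  fixes u :: "real \<Rightarrow> real"
  assumes "t \<ge> 0"
    and *: "\<And>e. e > 0 \<Longrightarrow> \<exists>d>0. \<forall>a b. 0 \<le> a \<and> a \<le> b \<and> \<bar>a - t\<bar> < d \<and> \<bar>b - t\<bar> < d \<longrightarrow>
        \<bar>u b - u a - (b - a) * D\<bar> \<le> (b - a) * e"
  shows "(u has_real_derivative D) (at t within {0..})"
  unfolding has_field_derivative_def has_derivative_within_alt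
proof (intro conjI allI impI)
  fix e :: real assume "e > 0"
  then obtain d where d: "d > 0" "\<And>a b. 0 \<le> a \<Longrightarrow> a \<le> b \<Longrightarrow> \<bar>a - t\<bar> < d \<Longrightarrow> \<bar>b - t\<bar> < d \<Longrightarrow>
        \<bar>u b - u a - (b - a) * D\<bar> \<le> (b - a) * e"
    using *[of e] by blast
  have "\<bar>u s - u t - D * (s - t)\<bar> \<le> e * \<bar>s - t\<bar>" if s: "s \<ge> 0" "\<bar>s - t\<bar> < d" for s
  proof (cases "s \<le> t")
    case True
    then have "\<bar>u t - u s - (t - s) * D\<bar> \<le> (t - s) * e" using d(2)[of s t] s d(1) by simp
    moreover have "u t - u s - (t - s) * D = - (u s - u t - D * (s - t))" by algebra
    ultimately show ?thesis using True by (simp only: abs_minus_cancel) (simp add: mult.commute)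
  next
    case False
    then have "\<bar>u s - u t - (s - t) * D\<bar> \<le> (s - t) * e" using d(2)[of t s] s d(1) \<open>t \<ge> 0\<close> by simp
    then show ?thesis using False by (simp add: mult.commute)
  qed
  then show "\<exists>d>0. \<forall>y\<in>{0..}. norm (y - t) < d \<longrightarrow>
      norm (u y - u t - D * (y - t)) \<le> e * norm (y - t)"
    using d(1) by auto
qed (rule bounded_linear_mult_right)

text \<open>The speed bound \<open>C i\<close> may depend on the coordinate. It confines coordinate
  \<open>i\<close> at time \<open>t\<close> to a compact interval, so no blow-up occurs and one
  limit serves all times.\<close>

theorem peano_product:
  fixes f :: "('i \<Rightarrow> real) \<Rightarrow> 'i \<Rightarrow> real" and x0 :: "'i \<Rightarrow> real"
  assumes cont: "\<And>i. continuous_on UNIV (\<lambda>x. f x i)"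
    and bound: "\<And>x i. \<bar>f x i\<bar> \<le> C i"
  obtains u where "\<And>i. u i 0 = x0 i"
    "\<And>i t. t \<ge> 0 \<Longrightarrow> (u i has_real_derivative f (\<lambda>j. u j t) i) (at t within {0..})"
proof -
  have C: "C i \<ge> 0" for i using bound[of x0 i] by linarith
  define h :: "nat \<Rightarrow> real" where "h n = inverse (real (Suc n))" for n
  define g :: "nat \<Rightarrow> real \<Rightarrow> nat" where "g n t = nat \<lfloor>t / h n\<rfloor>" for n t
  define X where "X n = euler f (h n) x0" for n
  \<comment> \<open>Pairs of coordinate and time index the product, so a single compactness argument
    handles both. \<open>g n t\<close> counts the complete steps made by time
    \<open>t\<close>.\<close>
  define U where "U n = (\<lambda>(i, t). X n (g n t) i)" for n
  have h: "h n > 0" for n by (simp add: h_def)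
  have h0: "h \<longlonglongrightarrow> 0"
    unfolding h_def by (rule LIMSEQ_inverse_real_of_nat)
  \<comment> \<open>For negative \<open>t\<close> the truncation by \<open>nat\<close> gives
    \<open>g n t = 0\<close>, so the estimate holds at every index of the product.\<close>
  have g_le: "h n * real (g n t) \<le> \<bar>t\<bar>" for n t
  proof (cases "t \<ge> 0")
    case True
    then have "real (g n t) \<le> t / h n" using h[of n] by (simp add: g_def)
    then show ?thesis using h[of n] True by (simp add: field_simps)
  next
    case False
    then have "g n t = 0" 
      using h[of n] by (simp add: g_def floor_le_iff divide_le_0_iff nat_eq_iff2 less_imp_le)
    then show ?thesis by simp
  qed
  have g: "\<bar>h n * real (g n t) - t\<bar> \<le> h n" if "t \<ge> 0" for n t
  proof -
    have "t / h n \<le> real (g n t) + 1"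
      using h[of n] that unfolding g_def by simp
    then have "t \<le> h n * real (g n t) + h n" using h[of n] by (simp add: field_simps)
    then show ?thesis using g_le[of n t] that h[of n] by simp
  qed
  have Lip: "\<bar>X n k i - X n m i\<bar> \<le> C i * \<bar>h n * real k - h n * real m\<bar>" for n k m i
    unfolding X_def using h[of n] bound by (intro euler_Lipschitz) auto
  define K where "K = (\<Pi>\<^sub>E z\<in>UNIV. {x0 (fst z) - C (fst z) * \<bar>snd z\<bar> .. x0 (fst z) + C (fst z) * \<bar>snd z :: real\<bar>})"
  have "compactin (product_topology (\<lambda>_. euclidean) UNIV) K"
    unfolding K_def compactin_PiE by simp
  then have "compact K" by (simp add: euclidean_product_topology)
  moreover have "U n \<in> K" for n
  proof -
    have "\<bar>X n (g n t) i - x0 i\<bar> \<le> C i * \<bar>t\<bar>" for i t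
    proof -
      have "\<bar>X n (g n t) i - X n 0 i\<bar> \<le> C i * \<bar>h n * real (g n t)\<bar>"
        using Lip[of n "g n t" i 0] by simp
      also have "\<dots> \<le> C i * \<bar>t\<bar>"
        using g_le[of n t] h[of n] C[of i] by (intro mult_left_mono) auto
      finally show ?thesis by (simp add: X_def)
    qed
    then show ?thesis
      by (auto simp: K_def U_def PiE_def Pi_def abs_le_iff algebra_simps)
  qed
  ultimately obtain p G where "G \<noteq> bot" and G: "G \<le> sequentially" and UG: "(U \<longlongrightarrow> p) G"
    using compact_cluster_filter[of K U sequentially] by (metis sequentially_bot)
  have lim: "((\<lambda>n. X n (g n t) i) \<longlongrightarrow> p (i, t)) G" for i t
  proof -
    have "((\<lambda>n. U n (i, t)) \<longlongrightarrow> p (i, t)) G"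
      by (rule continuous_on_tendsto_compose[OF continuous_on_product_coordinates UG]) auto
    then show ?thesis by (simp add: U_def)
  qed
  have h0G: "(h \<longlongrightarrow> 0) G" using h0 G by (rule tendsto_mono[rotated])
  have gG: "((\<lambda>n. h n * real (g n t)) \<longlongrightarrow> t) G" if "t \<ge> 0" for t
  proof -
    have "((\<lambda>n. h n * real (g n t) - t) \<longlongrightarrow> 0) G"
      by (rule Lim_null_comparison[OF _ h0G]) (use g[OF that] in auto)
    then show ?thesis by (simp add: LIM_zero_iff)
  qed
  define u where "u i t = p (i, t)" for i t
  have "u i 0 = x0 i" for i
  proof -
    have "((\<lambda>n. x0 i) \<longlongrightarrow> u i 0) G"
      using lim[of 0 i] by (simp add: u_def g_def X_def)
    then show ?thesis using \<open>G \<noteq> bot\<close> by (simp add: tendsto_const_iff)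
  qed
  moreover have "(u i has_real_derivative f (\<lambda>j. u j t) i) (at t within {0..})" if t: "t \<ge> 0" for i t
  proof (rule has_real_derivative_atLeast_0I[OF t])
    fix e :: real assume "e > 0"
    let ?y = "\<lambda>j. u j t"
    let ?S = "{x. \<bar>f x i - f ?y i\<bar> < e}"
    have "open ?S"
      by (intro open_Collect_less continuous_intros cont)
    moreover have "?y \<in> ?S" using \<open>e > 0\<close> by simp
    \<comment> \<open>Since \<open>J\<close> is finite, one radius \<open>d\<close> in time and one
      \<open>G\<close>-eventual condition on \<open>n\<close> will do for all its
      coordinates.\<close>
    ultimately obtain W J where J: "finite J" and W: "\<And>j. open (W j)" "\<And>j. ?y j \<in> W j"
      and WS: "\<And>x. (\<And>j. j \<in> J \<Longrightarrow> x j \<in> W j) \<Longrightarrow> x \<in> ?S"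
      using open_contains_product_basis by metis
    \<comment> \<open>All iterates at grid times within \<open>d\<close> of \<open>t\<close> are
      captured at once, uniformly in the step number \<open>l\<close>.\<close>
    let ?near = "\<lambda>d j. \<forall>\<^sub>F n in G. \<forall>l. \<bar>h n * real l - t\<bar> \<le> d \<longrightarrow> X n l j \<in> W j"
    have "\<forall>\<^sub>F d in at_right 0. ?near d j" for j
    proof -
      \<comment> \<open>The radius \<open>r\<close> is split in three: motion during time
        \<open>d\<close>, the grid error \<open>h n\<close>, and the distance of
        \<open>X n (g n t) j\<close> from its limit.\<close>
      obtain r where r: "r > 0" "ball (?y j) r \<subseteq> W j"
        using W open_contains_ball by metis
      have "((\<lambda>d. C j * d) \<longlongrightarrow> C j * 0) (at_right 0)"
        by (intro tendsto_intros)
      then have "\<forall>\<^sub>F d in at_right 0. C j * d < r / 3"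
        using r(1) by (intro order_tendstoD(2)[where y = "C j * 0"]) auto
      then show ?thesis
      proof eventually_elim
        case (elim d)
        have "((\<lambda>n. C j * h n) \<longlongrightarrow> C j * 0) G"
          by (intro tendsto_intros h0G)
        then have "\<forall>\<^sub>F n in G. C j * h n < r / 3"
          using r(1) by (intro order_tendstoD(2)[where y = "C j * 0"]) auto
        moreover have "\<forall>\<^sub>F n in G. dist (X n (g n t) j) (?y j) < r / 3"
          using lim[of t j] r(1) unfolding u_def by (intro tendstoD) auto
        ultimately show ?case
        proof eventually_elim
          case (elim n)
          show ?case
          proof (intro allI impI)
            fix l assume l: "\<bar>h n * real l - t\<bar> \<le> d"
            have "\<bar>X n l j - X n (g n t) j\<bar> \<le> C j * \<bar>h n * real l - h n * real (g n t)\<bar>"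
              by (rule Lip)
            also have "\<dots> \<le> C j * (d + h n)"
              using l g[OF t, of n] C[of j] by (intro mult_left_mono) auto
            also have "\<dots> < 2 * r / 3"
              using elim(1) \<open>C j * d < r / 3\<close> by (simp add: distrib_left)
            finally have "dist (?y j) (X n l j) < r"
              using elim(2) unfolding dist_real_def by linarith
            then show "X n l j \<in> W j" using r(2) by auto
          qed
        qed
      qed
    qed
    then have "\<forall>\<^sub>F d in at_right 0. \<forall>j\<in>J. ?near d j"
      by (intro eventually_ball_finite[OF J]) auto
    then have "\<forall>\<^sub>F d in at_right 0. d > 0 \<and> (\<forall>j\<in>J. ?near d j)"
      using eventually_at_right_less by (rule eventually_conj[rotated])
    then obtain d where d: "d > 0" "\<And>j. j \<in> J \<Longrightarrow> ?near d j"
      using eventually_happens'[OF trivial_limit_at_right_real] by blast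
    have near: "\<forall>\<^sub>F n in G. \<forall>l. \<bar>h n * real l - t\<bar> \<le> d \<longrightarrow> \<bar>f (X n l) i - f ?y i\<bar> \<le> e"
    proof -
      have "\<forall>\<^sub>F n in G. \<forall>j\<in>J. \<forall>l. \<bar>h n * real l - t\<bar> \<le> d \<longrightarrow> X n l j \<in> W j"
        using d(2) by (intro eventually_ball_finite[OF J]) auto
      then show ?thesis
      proof eventually_elim
        case (elim n)
        then have "X n l \<in> ?S" if "\<bar>h n * real l - t\<bar> \<le> d" for l
          using that by (intro WS) blast
        then show ?case by (auto intro: less_imp_le)
      qed
    qed
    \<comment> \<open>The drift estimate for steps \<open>g n a\<close> to \<open>g n b\<close>
      passes to the limit along \<open>G\<close>. The grid times involved lie in
      \<open>[a - h n, b]\<close>; with \<open>a\<close>, \<open>b\<close> within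
      \<open>d / 2\<close> of \<open>t\<close> and \<open>h n < d / 2\<close>, they stay within
      \<open>d\<close> of \<open>t\<close>.\<close>
    have "\<bar>u i b - u i a - (b - a) * f ?y i\<bar> \<le> (b - a) * e"
      if ab: "0 \<le> a" "a \<le> b" "\<bar>a - t\<bar> < d / 2" "\<bar>b - t\<bar> < d / 2" for a b
    proof (rule tendsto_le[OF \<open>G \<noteq> bot\<close>])
      let ?D = "\<lambda>n. h n * (real (g n b) - real (g n a))"
      have D: "(?D \<longlongrightarrow> b - a) G"
        using tendsto_diff[OF gG[of b] gG[of a]] ab by (simp add: right_diff_distrib)
      show "((\<lambda>n. \<bar>X n (g n b) i - X n (g n a) i - ?D n * f ?y i\<bar>)
          \<longlongrightarrow> \<bar>u i b - u i a - (b - a) * f ?y i\<bar>) G"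
        unfolding u_def by (intro tendsto_intros lim D)
      show "((\<lambda>n. ?D n * e) \<longlongrightarrow> (b - a) * e) G"
        by (intro tendsto_intros D)
      have "\<forall>\<^sub>F n in G. h n < d / 2"
        using h0G d(1) by (intro order_tendstoD(2)[where y = 0]) auto
      with near show "\<forall>\<^sub>F n in G. \<bar>X n (g n b) i - X n (g n a) i - ?D n * f ?y i\<bar> \<le> ?D n * e"
      proof eventually_elim
        case (elim n)
        have "a / h n \<le> b / h n" using ab h[of n] by (simp add: divide_right_mono)
        then have "g n a \<le> g n b" unfolding g_def by (intro nat_mono floor_mono)
        then show ?case
          unfolding X_def
        proof (rule euler_drift[OF less_imp_le[OF h]])
          fix l assume l: "g n a \<le> l" "l < g n b"
          have "h n * real (g n a) \<le> h n * real l" "h n * real l \<le> h n * real (g n b)"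
            using l h[of n] by auto
          then have "\<bar>h n * real l - t\<bar> \<le> d"
            using g[of a n] g_le[of n b] ab elim(2) by linarith
          then show "\<bar>f (euler f (h n) x0 l) i - f ?y i\<bar> \<le> e"
            using elim(1) by (simp add: X_def)
        qed
      qed
    qed
    then show "\<exists>d>0. \<forall>a b. 0 \<le> a \<and> a \<le> b \<and> \<bar>a - t\<bar> < d \<and> \<bar>b - t\<bar> < d \<longrightarrow>
        \<bar>u i b - u i a - (b - a) * f ?y i\<bar> \<le> (b - a) * e"
      using d(1) by (intro exI[of _ "d / 2"]) auto
  qed
  ultimately show thesis by (rule that)
qed

section \<open>Continuity of the extended curvature\<close>

definition cosine_quotient :: "real \<Rightarrow> real \<Rightarrow> real \<Rightarrow> real" where
  "cosine_quotient a b c = (cosh b * cosh c - cosh a) / (sinh b * sinh c)"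

text \<open>Clearing the positive denominator turns the bound into a comparison of
  \<open>cosh a\<close> with \<open>cosh (b + c)\<close>, and cosh is increasing on nonnegative
  reals.\<close>

lemma cosine_quotient_le_minus_1_iff:
  assumes "a > 0" "b > 0" "c > 0"
  shows "cosine_quotient a b c \<le> -1 \<longleftrightarrow> b + c \<le> a"
proof -
  have "sinh b * sinh c > 0" using assms by simp
  then have "cosine_quotient a b c \<le> -1 \<longleftrightarrow> cosh (b + c) \<le> cosh a"
    unfolding cosine_quotient_def by (subst pos_divide_le_eq) (auto simp: cosh_add)
  also have "\<dots> \<longleftrightarrow> b + c \<le> a"
    using assms by (intro cosh_real_nonneg_le_iff) auto
  finally show ?thesis .
qed

text \<open>Same argument with \<open>cosh (b - c)\<close>; evenness of cosh produces the absolute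
  value, which merges the two degenerate cases of angle 0.\<close>

lemma cosine_quotient_ge_1_iff:
  assumes "a > 0" "b > 0" "c > 0"
  shows "1 \<le> cosine_quotient a b c \<longleftrightarrow> a \<le> \<bar>b - c\<bar>"
proof -
  have "sinh b * sinh c > 0" using assms by simp
  then have "1 \<le> cosine_quotient a b c \<longleftrightarrow> cosh a \<le> cosh (b - c)"
    unfolding cosine_quotient_def by (subst pos_le_divide_eq) (auto simp: cosh_diff)
  also have "\<dots> \<longleftrightarrow> cosh a \<le> cosh \<bar>b - c\<bar>"
    by (simp add: cosh_real_abs)
  also have "\<dots> \<longleftrightarrow> a \<le> \<bar>b - c\<bar>"
    using assms by (intro cosh_real_nonneg_le_iff) auto
  finally show ?thesis .
qed

text \<open>Truncation at -1 and 1 reproduces the values pi and 0 exactly where a triangle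
  inequality fails. The case distinction becomes a composition of continuous functions, with no
  gluing along the degenerate locus.\<close>

lemma ext_angle_eq_arccos:
  assumes pos: "d {j, k} > 0" "d {i, j} > 0" "d {i, k} > 0"
  shows "ext_angle d i j k =
    arccos (max (-1) (min 1 (cosine_quotient (d {j, k}) (d {i, j}) (d {i, k}))))"
proof -
  let ?a = "d {j, k}" and ?b = "d {i, j}" and ?c = "d {i, k}"
  note iffs = cosine_quotient_le_minus_1_iff[OF pos] cosine_quotient_ge_1_iff[OF pos]
  consider "?b + ?c \<le> ?a" | "?a \<le> \<bar>?b - ?c\<bar>" "\<not> ?b + ?c \<le> ?a"
    | "\<not> ?b + ?c \<le> ?a" "\<not> ?a \<le> \<bar>?b - ?c\<bar>" by blast
  then show ?thesis
  proof cases
    case 1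
    then show ?thesis using iffs by (simp add: ext_angle_def max_absorb1)
  next
    case 2
    then have "?c \<ge> ?b + ?a \<or> ?b \<ge> ?c + ?a" by linarith
    then show ?thesis using 2 iffs by (simp add: ext_angle_def)
  next
    case 3
    then have "?a < ?b + ?c" "?b < ?a + ?c" "?c < ?a + ?b"
      by linarith+
    then have "ext_angle d i j k = arccos (cosine_quotient ?a ?b ?c)"
      using hyp_angle_eq[OF pos] by (simp add: ext_angle_def cosine_quotient_def)
    then show ?thesis using 3 iffs by simp
  qed
qed

lemma ext_angle_bounds:
  assumes "d {j, k} > 0" "d {i, j} > 0" "d {i, k} > 0"
  shows "0 \<le> ext_angle d i j k" "ext_angle d i j k \<le> pi"
  unfolding ext_angle_eq_arccos[of d, OF assms] by (auto intro: arccos_lbound arccos_ubound)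

section \<open>Angles and curvature as functions of the scaling\<close>

lemma continuous_on_vertex_scaling: "continuous_on S (\<lambda>u. vertex_scaling u d e)"
proof -
  have "continuous_on S (\<lambda>u. u i)" for i :: nat
    by (rule continuous_on_subset[OF continuous_on_product_coordinates]) simp
  then show ?thesis
    unfolding vertex_scaling_def
    by (intro continuous_on_mult_left continuous_on_compose2[OF continuous_on_arsinh[of UNIV]]
        continuous_intros) auto
qed

text \<open>Vertex scaling keeps lengths positive, so for every \<open>u\<close> the arccos formula
  applies and the sinh denominators do not vanish.\<close>

lemma continuous_on_ext_angle_vertex_scaling:
  assumes "d {j, k} > 0" "d {i, j} > 0" "d {i, k} > 0"
  shows "continuous_on S (\<lambda>u. ext_angle (vertex_scaling u d) i j k)"
proof -
  have "continuous_on S (\<lambda>u. cosine_quotient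
      (vertex_scaling u d {j, k}) (vertex_scaling u d {i, j}) (vertex_scaling u d {i, k}))"
    unfolding cosine_quotient_def using assms
    by (intro continuous_intros continuous_on_vertex_scaling)
       (auto dest: vertex_scaling_pos[THEN less_imp_neq])
  then show ?thesis
    using assms by (simp only: ext_angle_eq_arccos vertex_scaling_pos)
      (intro continuous_on_arccos continuous_intros; auto)
qed

lemma PH_metric_face_pos:
  assumes "simplicial_2_complex V E F" "PH_metric E F d" "{i, j, k} \<in> F"
  shows "d {j, k} > 0" "d {i, j} > 0" "d {i, k} > 0"
proof -
  have "card {i, j, k} = 3" and edges: "\<And>e. e \<subseteq> {i, j, k} \<Longrightarrow> card e = 2 \<Longrightarrow> e \<in> E"
    using assms(1,3) unfolding simplicial_2_complex_def by blast+
  then have "i \<noteq> j" "i \<noteq> k" "j \<noteq> k"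
    by (auto simp: card_insert_if split: if_splits)
  then have "{j, k} \<in> E" "{i, j} \<in> E" "{i, k} \<in> E"
    by (auto intro: edges)
  then show "d {j, k} > 0" "d {i, j} > 0" "d {i, k} > 0"
    using assms(2) unfolding PH_metric_def by blast+
qed

lemma continuous_on_ext_curvature:
  assumes "simplicial_2_complex V E F" "PH_metric E F d"
  shows "continuous_on S (\<lambda>u. ext_curvature F d u i)"
  unfolding ext_curvature_def case_prod_unfold
  by (intro continuous_intros continuous_on_ext_angle_vertex_scaling)
     (use PH_metric_face_pos[OF assms] in auto)

text \<open>Every extended angle lies in \<open>[0, pi]\<close> and the number of summands does not
  depend on \<open>u\<close>; this supplies the speed bound at \<open>i\<close> for
  \<open>peano_product\<close>.\<close>

lemma abs_ext_curvature_le: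
  assumes "simplicial_2_complex V E F" "PH_metric E F d"
  shows "\<bar>ext_curvature F d u i\<bar> \<le> 2 * pi + real (card {(j, k). j < k \<and> {i, j, k} \<in> F}) * pi"
proof -
  let ?P = "{(j, k). j < k \<and> {i, j, k} \<in> F}"
  let ?T = "\<Sum>(j, k)\<in>?P. ext_angle (vertex_scaling u d) i j k"
  have *: "0 \<le> ext_angle (vertex_scaling u d) i j k \<and> ext_angle (vertex_scaling u d) i j k \<le> pi"
    if "(j, k) \<in> ?P" for j k
    using that PH_metric_face_pos[OF assms, of i j k] by (simp add: ext_angle_bounds vertex_scaling_pos)
  have "?T \<ge> 0" by (rule sum_nonneg) (use * in auto)
  \<comment> \<open>Were \<open>?P\<close> infinite, the sum and \<open>card\<close> would both be 0
    by convention, so the inequality is the same in all cases.\<close>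
  moreover have "?T \<le> real (card ?P) * pi" by (rule sum_bounded_above) (use * in auto)
  ultimately show ?thesis unfolding ext_curvature_def by (simp add: abs_le_iff) (use pi_gt_zero in linarith)
qed

section \<open>Existence of the flow for all time\<close>

theorem theorem1p6:
  fixes M :: "'a topology" and V :: "nat set" and E F :: "nat set set" and d0 :: "nat set \<Rightarrow> real"
  assumes "infinitely_triangulated_surface M V E F"
    and "PH_metric E F d0"
  shows "\<exists>u \<in> C1_t V. extended_Yamabe_flow_solution V F d0 u"
proof -
  have VEF: "simplicial_2_complex V E F"
    using assms(1) by (simp add: infinitely_triangulated_surface_def)
  note cont = continuous_on_ext_curvature[OF VEF assms(2)]
  obtain u where u0: "\<And>i. u i 0 = 0"
    and u': "\<And>i t. t \<ge> 0 \<Longrightarrow>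
      (u i has_real_derivative - ext_curvature F d0 (\<lambda>j. u j t) i) (at t within {0..})"
  \<comment> \<open>The system is solved for every natural number as label. A label outside
    \<open>V\<close> lies in no face, so it moves with velocity -2 pi and does not influence the
    curvature at vertices.\<close>
  proof (rule peano_product[of "\<lambda>u i. - ext_curvature F d0 u i"
        "\<lambda>i. 2 * pi + real (card {(j, k). j < k \<and> {i, j, k} \<in> F}) * pi" "\<lambda>_. 0"])
    show "continuous_on UNIV (\<lambda>u. - ext_curvature F d0 u i)" for i
      by (intro continuous_intros cont)
  qed (use abs_ext_curvature_le[OF VEF assms(2)] in auto)
  \<comment> \<open>The derivative is the continuous curvature composed with the curve
    \<open>u\<close>, which is continuous into the product because each coordinate is
    differentiable.\<close>
  have "continuous_on {0..} (\<lambda>t. - ext_curvature F d0 (\<lambda>j. u j t) i)" for i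
  proof -
    have "continuous_on {0..} (\<lambda>t j. u j t)"
      by (intro continuous_on_coordinatewise_then_product DERIV_continuous_on) (rule u', simp)
    then show ?thesis
      by (intro continuous_on_minus continuous_on_compose2[OF cont[of UNIV]]) auto
  qed
  with u' have "u \<in> C1_t V"
    unfolding C1_t_def by blast
  moreover have "extended_Yamabe_flow_solution V F d0 u"
    unfolding extended_Yamabe_flow_solution_def using u0 u' by blast
  ultimately show ?thesis by blast
qed

end
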